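(* Let $X\subseteq\mathbb{N}$ and $n\ge1$, and let $X^*\subseteq[n]$ be defined by $i\in X^*\iff n+1-i\in X\cap[n]$. Then for every $s\ge0$, $Q_{n,s}^X=P_{n,s}^{X^*}$.
   Context: $S_n$ is the set of permutations $\sigma=\sigma_1\cdots\sigma_n$ of $[n]$. For $X\subseteq\mathbb{N}$, $P_{n,s}^X$ is the number of $\sigma\in S_n$ with exactly $s$ indices $i$ such that $\sigma_i>\sigma_{i+1}$ and $\sigma_i\in X$ (descents with top in $X$), and $Q_{n,s}^X$ is the number of $\sigma\in S_n$ with exactly $s$ indices $i$ such that $\sigma_i>\sigma_{i+1}$ and $\sigma_{i+1}\in X$ (descents with bottom in $X$). *)

theory Defs
  imports "HOL-Combinatorics.Permutations"
begin

text \<open>A permutation \<open>\<sigma>\<close> of \<open>[n]\<close>, read as the word \<open>\<sigma> 1 \<dots> \<sigma> n\<close>, is a function with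
  \<open>\<sigma> permutes {1..n}\<close>. The positions that can carry a descent are \<open>1, \<dots>, n - 1\<close>: the value
  \<open>\<sigma> (n + 1) = n + 1\<close> is not a letter of the word.\<close>

definition des_top :: "nat set \<Rightarrow> nat \<Rightarrow> (nat \<Rightarrow> nat) \<Rightarrow> nat set" where
  "des_top X n \<sigma> = {i \<in> {1..<n}. \<sigma> i > \<sigma> (i + 1) \<and> \<sigma> i \<in> X}"

definition des_bot :: "nat set \<Rightarrow> nat \<Rightarrow> (nat \<Rightarrow> nat) \<Rightarrow> nat set" where
  "des_bot X n \<sigma> = {i \<in> {1..<n}. \<sigma> i > \<sigma> (i + 1) \<and> \<sigma> (i + 1) \<in> X}"

definition P :: "nat set \<Rightarrow> nat \<Rightarrow> nat \<Rightarrow> nat" where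
  "P X n s = card {\<sigma>. \<sigma> permutes {1..n} \<and> card (des_top X n \<sigma>) = s}"

definition Q :: "nat set \<Rightarrow> nat \<Rightarrow> nat \<Rightarrow> nat" where
  "Q X n s = card {\<sigma>. \<sigma> permutes {1..n} \<and> card (des_bot X n \<sigma>) = s}"

definition star :: "nat \<Rightarrow> nat set \<Rightarrow> nat set" where
  "star n X = {i \<in> {1..n}. n + 1 - i \<in> X \<inter> {1..n}}"

end

theory Submission
  imports Defs
begin

text \<open>The reverse-complement \<open>\<sigma> \<mapsto> \<tau>\<close>, \<open>\<tau> i = n + 1 - \<sigma> (n + 1 - i)\<close>, is an
  involution of \<open>S\<^sub>n\<close>. It turns a descent of \<open>\<sigma>\<close> at position \<open>i\<close> with bottom \<open>b\<close> into a descent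
  of \<open>\<tau>\<close> at position \<open>n - i\<close> with top \<open>n + 1 - b\<close>.\<close>

text \<open>The identity branch is what \<open>permutes\<close> demands outside
  \<open>{1..n}\<close>. It also makes the map an involution on all of \<open>nat\<close>, which
  truncated subtraction alone would not give.\<close>

definition refl_upto :: "nat \<Rightarrow> nat \<Rightarrow> nat" where
  "refl_upto n i = (if i \<in> {1..n} then n + 1 - i else i)"

definition rev_compl :: "nat \<Rightarrow> (nat \<Rightarrow> nat) \<Rightarrow> nat \<Rightarrow> nat" where
  "rev_compl n \<sigma> = refl_upto n \<circ> \<sigma> \<circ> refl_upto n"

lemma refl_upto_refl_upto [simp]: "refl_upto n (refl_upto n i) = i"
  by (auto simp: refl_upto_def)

lemma refl_upto_permutes: "refl_upto n permutes {1..n}"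
  unfolding permutes_def
proof (intro conjI allI impI)
  fix x assume "x \<notin> {1..n}"
  then show "refl_upto n x = x" by (auto simp: refl_upto_def)
next
  fix y show "\<exists>!x. refl_upto n x = y" by (metis refl_upto_refl_upto)
qed

lemma rev_compl_rev_compl [simp]: "rev_compl n (rev_compl n \<sigma>) = \<sigma>"
  by (simp add: rev_compl_def fun_eq_iff)

lemma rev_compl_permutes: "\<sigma> permutes {1..n} \<Longrightarrow> rev_compl n \<sigma> permutes {1..n}"
  unfolding rev_compl_def by (intro permutes_compose refl_upto_permutes)

lemma rev_compl_apply:
  assumes "\<sigma> permutes {1..n}" "i \<in> {1..n}"
  shows "rev_compl n \<sigma> i = n + 1 - \<sigma> (n + 1 - i)"
proof -
  have "n + 1 - i \<in> {1..n}" using assms(2) by auto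
  then have "\<sigma> (n + 1 - i) \<in> {1..n}" using permutes_in_image[OF assms(1)] by blast
  then show ?thesis using assms(2) by (simp add: rev_compl_def refl_upto_def)
qed

text \<open>Reversal swaps the two letters of an adjacent pair and complementation reverses their
  order, so a descent stays a descent, while its old bottom \<open>\<sigma> (n - i + 1)\<close>
  becomes, complemented, the new top.\<close>

lemma rev_compl_descent_iff:
  assumes "\<sigma> permutes {1..n}" "i \<in> {1..<n}"
  shows "i \<in> des_top (star n X) n (rev_compl n \<sigma>) \<longleftrightarrow> n - i \<in> des_bot X n \<sigma>"
proof -
  have shift: "n + 1 - i = n - i + 1" "n + 1 - (i + 1) = n - i" using assms(2) by auto
  have "n - i \<in> {1..n}" "n - i + 1 \<in> {1..n}" using assms(2) by auto
  \<comment> \<open>Within these bounds subtraction from \<open>n + 1\<close> is not truncated: it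
    reverses strict order and undoes itself, which turns membership in \<open>star n X\<close> into
    membership in \<open>X\<close>.\<close>
  then have range: "\<sigma> (n - i) \<in> {1..n}" "\<sigma> (n - i + 1) \<in> {1..n}"
    using permutes_in_image[OF assms(1)] by blast+
  have "rev_compl n \<sigma> i = n + 1 - \<sigma> (n - i + 1)" "rev_compl n \<sigma> (i + 1) = n + 1 - \<sigma> (n - i)"
    using rev_compl_apply[OF assms(1), of i] rev_compl_apply[OF assms(1), of "i + 1"] assms(2)
    unfolding shift by auto
  then show ?thesis
    using range assms(2) unfolding des_top_def des_bot_def star_def by auto linarith+
qed

text \<open>The map \<open>i \<mapsto> n - i\<close> is its own inverse on \<open>{1..<n}\<close>
  and matches the descent positions of the two words.\<close>

lemma card_des_top_rev_compl:
  assumes "\<sigma> permutes {1..n}"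
  shows "card (des_top (star n X) n (rev_compl n \<sigma>)) = card (des_bot X n \<sigma>)"
proof (rule bij_betw_same_card)
  have top: "des_top (star n X) n (rev_compl n \<sigma>) \<subseteq> {1..<n}" and bot: "des_bot X n \<sigma> \<subseteq> {1..<n}"
    by (auto simp: des_top_def des_bot_def)
  have "n - i \<in> des_top (star n X) n (rev_compl n \<sigma>)" if "i \<in> des_bot X n \<sigma>" for i
  proof -
    have "n - i \<in> {1..<n}" "n - (n - i) = i" using that bot by fastforce+
    then show ?thesis using rev_compl_descent_iff[OF assms, of "n - i" X] that by simp
  qed
  moreover have "n - i \<in> des_bot X n \<sigma>" if "i \<in> des_top (star n X) n (rev_compl n \<sigma>)" for i
    using rev_compl_descent_iff[OF assms, of i X] that top by auto
  ultimately show "bij_betw (\<lambda>i. n - i) (des_top (star n X) n (rev_compl n \<sigma>)) (des_bot X n \<sigma>)"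
    using top bot by (intro bij_betw_byWitness[where f' = "\<lambda>i. n - i"]) auto
qed

theorem theorem2p9:
  fixes X :: "nat set" and n s :: nat
  assumes "n \<ge> 1"
  shows "Q X n s = P (star n X) n s"
  unfolding Q_def P_def
proof (rule bij_betw_same_card)
  \<comment> \<open>This is the same count read backwards, with
    \<open>\<sigma> = rev_compl n \<tau>\<close>; it shows that the inverse map also lands in the
    right set.\<close>
  have "card (des_bot X n (rev_compl n \<tau>)) = card (des_top (star n X) n \<tau>)"
    if "\<tau> permutes {1..n}" for \<tau>
    using card_des_top_rev_compl[OF rev_compl_permutes[OF that], of X] by simp
  then show "bij_betw (rev_compl n)
      {\<sigma>. \<sigma> permutes {1..n} \<and> card (des_bot X n \<sigma>) = s}
      {\<sigma>. \<sigma> permutes {1..n} \<and> card (des_top (star n X) n \<sigma>) = s}"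
    by (intro bij_betw_byWitness[where f' = "rev_compl n"])
      (auto simp: rev_compl_permutes card_des_top_rev_compl simp del: One_nat_def)
qed

end
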